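(* There is a nonempty set $A\subseteq\omega$ such that $\mathcal E_A$ has no recursive member, and yet every closed $\mathcal C\subseteq\omega^\omega$ with $\mathcal C\leq_{\mathrm s}\mathcal E_A$ has a recursive member. That is, there is a nonzero degree of enumerability that does not bound any nonzero closed Medvedev degree.
   Context: $\mathcal E_A=\{f\in\omega^\omega:\mathrm{ran}(f)=A\}$; a degree of enumerability is a Medvedev degree of this form for nonempty $A$. $\mathcal A\leq_{\mathrm s}\mathcal B$ iff there is a Turing functional $\Phi$ with $\Phi(f)$ total and in $\mathcal A$ for all $f\in\mathcal B$. A Medvedev degree is zero iff its mass problems have a recursive member, and closed iff it contains a closed subset of Baire space. *)

theory Defs
  imports "HOL-Analysis.Function_Topology"
begin

text \<open>
  Turing functionals are rendered by Kleene's partial recursive functions relative to an oracle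
  \<open>h :: nat \<Rightarrow> nat\<close>: the initial functions together with \<open>h\<close> itself, closed under composition,
  primitive recursion and minimization. Arguments are passed as lists, and the arity of a
  program is implicit: an application to too few arguments (for \<open>Succ\<close> and \<open>Oracle\<close>: to a list
  of length other than one) is undefined.
\<close>

datatype prog =
    Zero
  | Succ
  | Proj nat
  | Oracle
  | Comp prog "prog list"
  | PrimRec prog prog
  | Mu prog

inductive eval :: "(nat \<Rightarrow> nat) \<Rightarrow> prog \<Rightarrow> nat list \<Rightarrow> nat \<Rightarrow> bool" for h :: "nat \<Rightarrow> nat" where
  eval_Zero: "eval h Zero xs 0"
| eval_Succ: "eval h Succ [x] (Suc x)"
| eval_Proj: "i < length xs \<Longrightarrow> eval h (Proj i) xs (xs ! i)"
| eval_Oracle: "eval h Oracle [x] (h x)"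
| eval_Comp: "list_all2 (\<lambda>q z. eval h q xs z) qs zs \<Longrightarrow> eval h p zs y \<Longrightarrow> eval h (Comp p qs) xs y"
| eval_PrimRec_0: "eval h p xs y \<Longrightarrow> eval h (PrimRec p q) (0 # xs) y"
| eval_PrimRec_Suc: "eval h (PrimRec p q) (n # xs) z \<Longrightarrow> eval h q (n # z # xs) y
    \<Longrightarrow> eval h (PrimRec p q) (Suc n # xs) y"
| eval_Mu: "eval h p (y # xs) 0 \<Longrightarrow> (\<forall>i<y. \<exists>z. eval h p (i # xs) (Suc z)) \<Longrightarrow> eval h (Mu p) xs y"

inductive_cases eval_ZeroE: "eval h Zero xs y"
inductive_cases eval_SuccE: "eval h Succ xs y"
inductive_cases eval_ProjE: "eval h (Proj i) xs y"
inductive_cases eval_OracleE: "eval h Oracle xs y"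
inductive_cases eval_CompE: "eval h (Comp p qs) xs y"
inductive_cases eval_PrimRec_0E: "eval h (PrimRec p q) (0 # xs) y"
inductive_cases eval_PrimRec_SucE: "eval h (PrimRec p q) (Suc n # xs) y"
inductive_cases eval_MuE: "eval h (Mu p) xs y"

lemma eval_deterministic:
  assumes "eval h p xs y" and "eval h p xs y'"
  shows "y = y'"
  using assms
proof (induction arbitrary: y' rule: eval.induct)
  case (eval_Zero xs)
  then show ?case by (rule eval_ZeroE) simp
next
  case (eval_Succ x)
  then show ?case by (rule eval_SuccE) simp
next
  case (eval_Proj i xs)
  from eval_Proj.prems show ?case by (rule eval_ProjE) simp
next
  case (eval_Oracle x)
  then show ?case by (rule eval_OracleE) simp
next
  case (eval_Comp xs qs zs p y)
  from eval_Comp.prems obtain zs'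
    where zs': "list_all2 (\<lambda>q z. eval h q xs z) qs zs'" "eval h p zs' y'"
    by (rule eval_CompE)
  have "zs = zs'"
  proof (rule nth_equalityI)
    show "length zs = length zs'"
      using list_all2_lengthD[OF eval_Comp.IH(1)] list_all2_lengthD[OF zs'(1)] by simp
    show "zs ! i = zs' ! i" if "i < length zs" for i
    proof -
      have i: "i < length qs" using list_all2_lengthD[OF eval_Comp.IH(1)] that by simp
      show ?thesis using list_all2_nthD[OF eval_Comp.IH(1) i] list_all2_nthD[OF zs'(1) i] by blast
    qed
  qed
  then show ?case using eval_Comp.IH(2) zs'(2) by blast
next
  case (eval_PrimRec_0 p xs y q)
  from eval_PrimRec_0.prems have "eval h p xs y'" by (rule eval_PrimRec_0E)
  then show ?case by (rule eval_PrimRec_0.IH)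
next
  case (eval_PrimRec_Suc p q n xs z y)
  from eval_PrimRec_Suc.prems obtain z'
    where "eval h (PrimRec p q) (n # xs) z'" "eval h q (n # z' # xs) y'"
    by (rule eval_PrimRec_SucE)
  then show ?case using eval_PrimRec_Suc.IH by blast
next
  case (eval_Mu p y xs)
  from eval_Mu.prems
  have *: "eval h p (y' # xs) 0 \<and> (\<forall>i<y'. \<exists>z. eval h p (i # xs) (Suc z))"
    by (rule eval_MuE) blast
  have "\<not> y < y'"
  proof
    assume "y < y'"
    with * obtain z where "eval h p (y # xs) (Suc z)" by blast
    from eval_Mu.IH(1)[OF this] show False by simp
  qed
  moreover have "\<not> y' < y"
  proof
    assume "y' < y"
    with eval_Mu.IH(2) obtain z where "\<forall>x. eval h p (y' # xs) x \<longrightarrow> Suc z = x" by blast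
    with * have "Suc z = 0" by blast
    then show False by simp
  qed
  ultimately show ?case by simp
qed

text \<open>The program \<open>p\<close>, as a Turing functional \<open>\<Phi>\<close>, has \<open>\<Phi>(f)\<close> total and equal to \<open>g\<close>.\<close>

definition functional_maps :: "prog \<Rightarrow> (nat \<Rightarrow> nat) \<Rightarrow> (nat \<Rightarrow> nat) \<Rightarrow> bool" where
  "functional_maps p f g \<longleftrightarrow> (\<forall>n. eval f p [n] (g n))"

fun oracle_free :: "prog \<Rightarrow> bool" where
  "oracle_free Zero \<longleftrightarrow> True"
| "oracle_free Succ \<longleftrightarrow> True"
| "oracle_free (Proj i) \<longleftrightarrow> True"
| "oracle_free Oracle \<longleftrightarrow> False"
| "oracle_free (Comp p qs) \<longleftrightarrow> oracle_free p \<and> (\<forall>q\<in>set qs. oracle_free q)"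
| "oracle_free (PrimRec p q) \<longleftrightarrow> oracle_free p \<and> oracle_free q"
| "oracle_free (Mu p) \<longleftrightarrow> oracle_free p"

text \<open>The oracle \<open>\<lambda>_. 0\<close> below is a dummy, since the program never queries it.\<close>

definition recursive_function :: "(nat \<Rightarrow> nat) \<Rightarrow> bool" where
  "recursive_function g \<longleftrightarrow> (\<exists>p. oracle_free p \<and> (\<forall>n. eval (\<lambda>_. 0) p [n] (g n)))"

type_synonym mass_problem = "(nat \<Rightarrow> nat) set"

definition has_recursive_member :: "mass_problem \<Rightarrow> bool" where
  "has_recursive_member \<A> \<longleftrightarrow> (\<exists>f\<in>\<A>. recursive_function f)"

definition medvedev_le :: "mass_problem \<Rightarrow> mass_problem \<Rightarrow> bool"  (infix "\<le>\<^sub>s" 50) where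
  "\<A> \<le>\<^sub>s \<B> \<longleftrightarrow> (\<exists>p. \<forall>f\<in>\<B>. \<exists>g\<in>\<A>. functional_maps p f g)"

definition enumerations :: "nat set \<Rightarrow> mass_problem" where
  "enumerations A = {f. range f = A}"

definition medvedev_degree :: "mass_problem \<Rightarrow> mass_problem set" where
  "medvedev_degree \<A> = {\<B>. \<A> \<le>\<^sub>s \<B> \<and> \<B> \<le>\<^sub>s \<A>}"

definition medvedev_degrees :: "mass_problem set set" where
  "medvedev_degrees = range medvedev_degree"

definition degree_le :: "mass_problem set \<Rightarrow> mass_problem set \<Rightarrow> bool" where
  "degree_le a b \<longleftrightarrow> (\<exists>\<A>\<in>a. \<exists>\<B>\<in>b. \<A> \<le>\<^sub>s \<B>)"

definition zero_degree :: "mass_problem set \<Rightarrow> bool" where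
  "zero_degree a \<longleftrightarrow> (\<forall>\<A>\<in>a. has_recursive_member \<A>)"

text \<open>
  \<open>closed\<close> refers to the product topology on \<open>nat \<Rightarrow> nat\<close> with \<open>nat\<close> discrete, that is,
  to Baire space.
\<close>

definition closed_degree :: "mass_problem set \<Rightarrow> bool" where
  "closed_degree a \<longleftrightarrow> (\<exists>\<C>\<in>a. closed \<C>)"

definition degree_of_enumerability :: "mass_problem set \<Rightarrow> bool" where
  "degree_of_enumerability a \<longleftrightarrow> (\<exists>A. A \<noteq> {} \<and> a = medvedev_degree (enumerations A))"

end

theory Submission
  imports Defs
begin

text \<open>
  If a recursive \<open>f\<close> has range inside \<open>A\<close> and \<open>\<Phi>(f)\<close> is total, then \<open>\<Phi>(f)\<close> is a recursive limit
  of values of \<open>\<Phi>\<close> on enumerations of \<open>A\<close>, because each initial segment of \<open>f\<close> extends to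
  an enumeration of \<open>A\<close>. So a closed set containing the image of the enumerations of \<open>A\<close> contains
  \<open>\<Phi>(f)\<close>. The set \<open>A\<close> is built by forcing with pairs \<open>(R, v)\<close> that demand
  \<open>R \<subseteq> A \<subseteq> R \<union> range v\<close>, where \<open>R\<close> is recursively enumerable and \<open>v\<close> is a recursive injection
  with range disjoint from \<open>R\<close>. For each \<open>\<Phi>\<close> a condition is extended so that either such an \<open>f\<close>
  exists or \<open>\<Phi>\<close> diverges on some enumeration of \<open>A\<close>; infinitely many elements stay undecided,
  which leaves room to make \<open>A\<close> differ from the range of every recursive function.
\<close>

section \<open>Recursive functions of several arguments\<close>

text \<open>\<open>F\<close> is constrained only on lists of length \<open>k\<close>, so it may be
  written freely with \<open>!\<close> and \<open>drop\<close>.\<close>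

definition recf :: "nat \<Rightarrow> (nat list \<Rightarrow> nat) \<Rightarrow> bool" where
  "recf k F \<longleftrightarrow> (\<exists>p. oracle_free p \<and> (\<forall>xs. length xs = k \<longrightarrow> eval (\<lambda>_. 0) p xs (F xs)))"

lemma recf_cong: "recf k F \<Longrightarrow> (\<And>xs. length xs = k \<Longrightarrow> F xs = G xs) \<Longrightarrow> recf k G"
  unfolding recf_def by metis

lemma recf_zero: "recf k (\<lambda>_. 0)"
  unfolding recf_def by (rule exI[of _ Zero]) (auto intro: eval.intros)

lemma recf_nth: "i < k \<Longrightarrow> recf k (\<lambda>xs. xs ! i)"
  unfolding recf_def by (rule exI[of _ "Proj i"]) (auto intro: eval.intros)

lemma recf_subst:
  assumes F: "recf (length Gs) F" and Gs: "\<And>G. G \<in> set Gs \<Longrightarrow> recf k G"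
  shows "recf k (\<lambda>xs. F (map (\<lambda>G. G xs) Gs))"
proof -
  obtain p where p: "oracle_free p" "\<And>xs. length xs = length Gs \<Longrightarrow> eval (\<lambda>_. 0) p xs (F xs)"
    using F unfolding recf_def by blast
  have "\<forall>G. \<exists>q. G \<in> set Gs \<longrightarrow>
    oracle_free q \<and> (\<forall>xs. length xs = k \<longrightarrow> eval (\<lambda>_. 0) q xs (G xs))"
    using Gs unfolding recf_def by blast
  then obtain Q where Q: "\<And>G. G \<in> set Gs \<Longrightarrow>
      oracle_free (Q G) \<and> (\<forall>xs. length xs = k \<longrightarrow> eval (\<lambda>_. 0) (Q G) xs (G xs))"
    by metis
  have "eval (\<lambda>_. 0) (Comp p (map Q Gs)) xs (F (map (\<lambda>G. G xs) Gs))" if "length xs = k" for xs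
    by (rule eval_Comp[where zs = "map (\<lambda>G. G xs) Gs"])
      (use Q p that in \<open>auto simp: list_all2_conv_all_nth\<close>)
  then show ?thesis
    unfolding recf_def using p Q by (intro exI[of _ "Comp p (map Q Gs)"]) auto
qed

lemma map_nth_upt_drop: "length ys = n \<Longrightarrow> map ((!) ys) [j..<n] = drop j ys"
  by (metis drop_map drop_upt add_0 map_nth)

text \<open>The last \<open>l\<close> arguments are passed on by projections. This serves functions
  with a parameter list of arbitrary length.\<close>

lemma recf_subst_drop:
  assumes F: "recf (length Gs + l) F" and Gs: "\<And>G. G \<in> set Gs \<Longrightarrow> recf (j + l) G"
  shows "recf (j + l) (\<lambda>ys. F (map (\<lambda>G. G ys) Gs @ drop j ys))"
proof -
  let ?Gs = "Gs @ map (\<lambda>i ys. ys ! i) [j..<j + l]"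
  have "recf (j + l) (\<lambda>ys. F (map (\<lambda>G. G ys) ?Gs))"
    by (rule recf_subst) (use F Gs in \<open>auto intro: recf_nth\<close>)
  then show ?thesis
    by (rule recf_cong) (simp add: comp_def map_nth_upt_drop)
qed

lemma recf_Suc: "recf k F \<Longrightarrow> recf k (\<lambda>xs. Suc (F xs))"
proof -
  have "recf 1 (\<lambda>xs. Suc (xs ! 0))"
    unfolding recf_def
    by (rule exI[of _ Succ]) (auto simp: length_Suc_conv intro: eval.intros)
  then show "recf k F \<Longrightarrow> ?thesis"
    using recf_subst[of "[F]" "\<lambda>xs. Suc (xs ! 0)" k] by simp
qed

lemma recf_const: "recf k (\<lambda>_. n)"
  by (induction n) (auto intro: recf_zero recf_Suc)

lemma recf_drop: "recf k F \<Longrightarrow> recf (j + k) (\<lambda>xs. F (drop j xs))"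
  using recf_subst_drop[of "[]" k F j] by simp

lemma recf_rec_nat:
  assumes P: "recf k P" and Q: "recf (2 + k) (\<lambda>ys. q (ys ! 0) (ys ! 1) (drop 2 ys))"
    and N: "recf k N"
  shows "recf k (\<lambda>xs. rec_nat (P xs) (\<lambda>m z. q m z xs) (N xs))"
proof -
  obtain p where p: "oracle_free p" "\<And>xs. length xs = k \<Longrightarrow> eval (\<lambda>_. 0) p xs (P xs)"
    using P unfolding recf_def by blast
  obtain r where r: "oracle_free r"
      "\<And>ys. length ys = 2 + k \<Longrightarrow> eval (\<lambda>_. 0) r ys (q (ys ! 0) (ys ! 1) (drop 2 ys))"
    using Q unfolding recf_def by blast
  have "eval (\<lambda>_. 0) (PrimRec p r) (n # xs) (rec_nat (P xs) (\<lambda>m z. q m z xs) n)"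
    if "length xs = k" for n xs
  proof (induction n)
    case 0
    show ?case using p(2)[OF that] by (auto intro: eval.intros)
  next
    case (Suc n)
    from r(2)[of "n # rec_nat (P xs) (\<lambda>m z. q m z xs) n # xs"] that
    show ?case using eval_PrimRec_Suc[OF Suc] by simp
  qed
  \<comment> \<open>\<open>PrimRec\<close> recurses on its first argument, so \<open>N\<close> is
    afterwards substituted for the head of the list.\<close>
  then have "recf (Suc k) (\<lambda>ys. rec_nat (P (tl ys)) (\<lambda>m z. q m z (tl ys)) (hd ys))"
    unfolding recf_def using p r
    by (intro exI[of _ "PrimRec p r"]) (auto simp: length_Suc_conv)
  from recf_subst_drop[of "[N]" k _ 0, simplified, OF this N]
  show ?thesis by simp
qed

text \<open>\<open>Mu\<close> must see a defined positive value at every number below its result;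
  \<open>q\<close> is total and the result is its least zero.\<close>

lemma recf_Least:
  assumes Q: "recf (Suc k) (\<lambda>ys. q (ys ! 0) (drop 1 ys))"
    and ex: "\<And>xs. length xs = k \<Longrightarrow> \<exists>y. q y xs = (0 :: nat)"
  shows "recf k (\<lambda>xs. LEAST y. q y xs = 0)"
proof -
  obtain r where r: "oracle_free r"
      "\<And>ys. length ys = Suc k \<Longrightarrow> eval (\<lambda>_. 0) r ys (q (ys ! 0) (drop 1 ys))"
    using Q unfolding recf_def by blast
  have "eval (\<lambda>_. 0) (Mu r) xs (LEAST y. q y xs = 0)" if len: "length xs = k" for xs
  proof (rule eval_Mu)
    have r': "eval (\<lambda>_. 0) r (y # xs) (q y xs)" for y using r(2)[of "y # xs"] len by simp
    show "eval (\<lambda>_. 0) r ((LEAST y. q y xs = 0) # xs) 0"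
      using r'[of "LEAST y. q y xs = 0"] LeastI_ex[OF ex[OF len]] by simp
    show "\<forall>i < (LEAST y. q y xs = 0). \<exists>z. eval (\<lambda>_. 0) r (i # xs) (Suc z)"
      using r' not_less_Least by (metis (mono_tags) not0_implies_Suc)
  qed
  then show ?thesis
    unfolding recf_def using r by (intro exI[of _ "Mu r"]) auto
qed

lemma recf_nth_drop: "j + i < k \<Longrightarrow> recf k (\<lambda>xs. drop j xs ! i)"
  by (rule recf_cong[OF recf_nth[of "j + i"]]) auto

lemma recf_add:
  assumes "recf k F" and "recf k G"
  shows "recf k (\<lambda>xs. F xs + G xs)"
proof -
  have "recf k (\<lambda>xs. rec_nat (F xs) (\<lambda>_ z. Suc z) (G xs))"
    by (intro recf_rec_nat recf_Suc recf_nth assms) auto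
  moreover have "rec_nat a (\<lambda>_ z. Suc z) b = a + b" for a b by (induction b) auto
  ultimately show ?thesis by simp
qed

lemma recf_pred:
  assumes "recf k F"
  shows "recf k (\<lambda>xs. F xs - 1)"
proof -
  have "recf k (\<lambda>xs. rec_nat 0 (\<lambda>m _. m) (F xs))"
    by (intro recf_rec_nat recf_zero recf_nth assms) auto
  moreover have "rec_nat 0 (\<lambda>m _. m) b = b - 1" for b :: nat by (cases b) auto
  ultimately show ?thesis by simp
qed

lemma recf_diff:
  assumes "recf k F" and "recf k G"
  shows "recf k (\<lambda>xs. F xs - G xs)"
proof -
  have "recf k (\<lambda>xs. rec_nat (F xs) (\<lambda>_ z. z - 1) (G xs))"
    by (intro recf_rec_nat recf_pred recf_nth assms) auto
  moreover have "rec_nat a (\<lambda>_ z. z - 1) b = a - b" for a b :: nat by (induction b) auto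
  ultimately show ?thesis by simp
qed

lemma recf_mult:
  assumes "recf k F" and "recf k G"
  shows "recf k (\<lambda>xs. F xs * G xs)"
proof -
  have "recf k (\<lambda>xs. rec_nat 0 (\<lambda>_ z. z + F xs) (G xs))"
    by (intro recf_rec_nat recf_add recf_zero recf_nth recf_drop assms) auto
  moreover have "rec_nat 0 (\<lambda>_ z. z + a) b = a * b" for a b :: nat by (induction b) auto
  ultimately show ?thesis by simp
qed

lemma recf_if_zero:
  assumes "recf k N" and "recf k F" and "recf k G"
  shows "recf k (\<lambda>xs. if N xs = 0 then F xs else G xs)"
proof -
  have "recf k (\<lambda>xs. rec_nat (F xs) (\<lambda>_ _. G xs) (N xs))"
    by (intro recf_rec_nat recf_drop assms)
  moreover have "rec_nat a (\<lambda>_ _. b) n = (if n = 0 then a else b)" for a b n :: nat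
    by (cases n) auto
  ultimately show ?thesis by simp
qed

lemma recf_sum:
  assumes "recf (Suc k) (\<lambda>ys. q (ys ! 0) (drop 1 ys))" and "recf k N"
  shows "recf k (\<lambda>xs. \<Sum>i < N xs. q i xs)"
proof -
  have *: "recf (2 + k) (\<lambda>ys. q (ys ! 0) (drop 2 ys))"
    using recf_subst_drop[of "[\<lambda>ys. ys ! 0]" k "\<lambda>ys. q (ys ! 0) (drop 1 ys)" 2] assms(1) recf_nth
    by simp
  have "recf k (\<lambda>xs. rec_nat 0 (\<lambda>i z. z + q i xs) (N xs))"
    by (intro recf_rec_nat recf_add recf_zero recf_nth * assms(2)) auto
  moreover have "rec_nat 0 (\<lambda>i z. z + q i xs) n = (\<Sum>i < n. q i xs)" for n xs
    by (induction n) auto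
  ultimately show ?thesis by simp
qed

lemma recursive_function_iff_recf: "recursive_function g \<longleftrightarrow> recf 1 (\<lambda>xs. g (xs ! 0))"
  unfolding recursive_function_def recf_def
  by (intro ex_cong1 conj_cong refl) (auto simp: length_Suc_conv)

lemma recf_recursive_function:
  assumes "recursive_function g" and "recf k F"
  shows "recf k (\<lambda>xs. g (F xs))"
  using recf_subst[of "[F]" "\<lambda>xs. g (xs ! 0)" k] assms by (simp add: recursive_function_iff_recf)

lemma recursive_function_comp:
  "recursive_function f \<Longrightarrow> recursive_function g \<Longrightarrow> recursive_function (\<lambda>n. f (g n))"
  unfolding recursive_function_iff_recf[where g = g]
    recursive_function_iff_recf[where g = "\<lambda>n. f (g n)"]
  by (rule recf_recursive_function[where g = f])

section \<open>Coding finite sequences\<close>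

text \<open>With truncated subtraction the equation says \<open>c < (s + 1)^2\<close>, so this is
  the integer square root, in the form that \<open>recf_Least\<close> takes.\<close>

definition sqrt_floor :: "nat \<Rightarrow> nat" where
  "sqrt_floor c = (LEAST s. Suc c - Suc s * Suc s = 0)"

text \<open>Robinson's unpairing: \<open>(a, b)\<close> is coded by \<open>s\<^sup>2 + a\<close> for any large \<open>s\<close> of the form \<open>r\<^sup>2 + b\<close>.\<close>

definition unpair1 :: "nat \<Rightarrow> nat" where
  "unpair1 c = c - sqrt_floor c * sqrt_floor c"

definition unpair2 :: "nat \<Rightarrow> nat" where
  "unpair2 c = unpair1 (sqrt_floor c)"

lemma recf_sqrt_floor: "recf k F \<Longrightarrow> recf k (\<lambda>xs. sqrt_floor (F xs))"
  unfolding sqrt_floor_def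
proof (rule recf_Least)
  assume F: "recf k F"
  then show "recf (Suc k) (\<lambda>ys. Suc (F (drop 1 ys)) - Suc (ys ! 0) * Suc (ys ! 0))"
    using recf_drop[of k F 1] by (intro recf_diff recf_Suc recf_mult recf_nth) auto
  show "\<exists>y. Suc (F xs) - Suc y * Suc y = 0" for xs
    by (rule exI[of _ "F xs"]) simp
qed

lemma recf_unpair1: "recf k F \<Longrightarrow> recf k (\<lambda>xs. unpair1 (F xs))"
  unfolding unpair1_def by (intro recf_diff recf_mult recf_sqrt_floor)

lemma recf_unpair2: "recf k F \<Longrightarrow> recf k (\<lambda>xs. unpair2 (F xs))"
  unfolding unpair2_def by (intro recf_unpair1 recf_sqrt_floor)

lemma sqrt_floor_eq: "a \<le> 2 * s \<Longrightarrow> sqrt_floor (s * s + a) = s"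
  unfolding sqrt_floor_def
proof (rule Least_equality)
  fix y assume "Suc (s * s + a) - Suc y * Suc y = 0"
  then have "s * s < Suc y * Suc y" by simp
  then show "s \<le> y" by (meson leI less_Suc_eq_le mult_le_mono not_le)
qed simp

lemma unpair_surj: "\<exists>c\<ge>t. unpair1 c = a \<and> unpair2 c = b"
proof -
  \<comment> \<open>Since \<open>r\<close> is at least \<open>b\<close> and \<open>s\<close> at
    least \<open>a\<close>, neither sum reaches the next square; the summand \<open>t\<close> makes
    the code large.\<close>
  define r where "r = a + b + t"
  define s where "s = r * r + b"
  define c where "c = s * s + a"
  have "b \<le> 2 * r" by (simp add: r_def)
  then have s: "unpair1 s = b" by (simp add: unpair1_def sqrt_floor_eq s_def)
  have "r \<le> s" using le_square[of r] unfolding s_def by linarith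
  moreover have "s \<le> c" using le_square[of s] unfolding c_def by linarith
  ultimately have "a \<le> 2 * s" "t \<le> c" by (auto simp: r_def)
  then show ?thesis
    using s by (intro exI[of _ c]) (auto simp: unpair2_def unpair1_def sqrt_floor_eq c_def)
qed

text \<open>Every number codes an infinite sequence, with head \<open>unpair1\<close> and code of
  the tail \<open>unpair2\<close>; no length is stored.\<close>

definition seq_nth :: "nat \<Rightarrow> nat \<Rightarrow> nat" where
  "seq_nth c i = unpair1 ((unpair2 ^^ i) c)"

lemma recf_seq_nth:
  assumes "recf k F" and "recf k G"
  shows "recf k (\<lambda>xs. seq_nth (F xs) (G xs))"
proof -
  have "recf k (\<lambda>xs. unpair1 (rec_nat (F xs) (\<lambda>_ z. unpair2 z) (G xs)))"
    by (intro recf_unpair1 recf_rec_nat recf_unpair2 recf_nth assms) auto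
  moreover have "rec_nat c (\<lambda>_ z. unpair2 z) i = (unpair2 ^^ i) c" for c i
    by (induction i) auto
  ultimately show ?thesis by (simp add: seq_nth_def)
qed

text \<open>The head is paired with a code of the tail. Codes beyond every \<open>t\<close> matter
  because a code will double as a time bound.\<close>

lemma seq_nth_surj: "\<exists>c\<ge>t. \<forall>i<n. seq_nth c i = h i"
proof (induction n arbitrary: h t)
  case (Suc n)
  obtain b where b: "\<And>i. i < n \<Longrightarrow> seq_nth b i = h (Suc i)"
    using Suc[where h = "\<lambda>i. h (Suc i)"] by blast
  obtain c where c: "c \<ge> t" "unpair1 c = h 0" "unpair2 c = b"
    using unpair_surj by blast
  have "seq_nth c i = h i" if "i < Suc n" for i
  proof (cases i)
    case (Suc j)
    then show ?thesis using b[of j] that c by (simp add: seq_nth_def funpow_swap1)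
  qed (simp add: seq_nth_def c)
  then show ?case using c by blast
qed auto

section \<open>Time-bounded evaluation\<close>

text \<open>
  The value \<open>0\<close> means that the search goes on, \<open>1\<close> that it met an undefined value, and
  \<open>y + 2\<close> that it found \<open>y\<close>.
\<close>

definition mu_search :: "(nat \<Rightarrow> nat) \<Rightarrow> nat \<Rightarrow> nat" where
  "mu_search v = rec_nat 0 (\<lambda>j w. if w = 0 then
     (if v j = 0 then 1 else if v j - 1 = 0 then Suc (Suc j) else 0) else w)"

lemma mu_search_simps:
  "mu_search v 0 = 0"
  "mu_search v (Suc j) = (if mu_search v j = 0 then
     (if v j = 0 then 1 else if v j - 1 = 0 then Suc (Suc j) else 0) else mu_search v j)"
  by (simp_all add: mu_search_def)

text \<open>In \<open>v\<close>, \<open>0\<close> stands for undefined and \<open>Suc z\<close> for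
  the value \<open>z\<close>, so \<open>v i > 1\<close> means defined and nonzero.\<close>

lemma mu_search_eq_0: "mu_search v j = 0 \<longleftrightarrow> (\<forall>i<j. v i > 1)"
  by (induction j) (auto simp: mu_search_simps less_Suc_eq)

lemma mu_search_sound:
  "mu_search v j = Suc (Suc y) \<Longrightarrow> v y = 1 \<and> (\<forall>i<y. v i > 1)"
  by (induction j) (auto simp: mu_search_simps mu_search_eq_0 split: if_splits)

lemma mu_search_complete:
  assumes "v y = 1" and "\<And>i. i < y \<Longrightarrow> v i > 1" and "y < j"
  shows "mu_search v j = Suc (Suc y)"
  using assms(3)
proof (induction j)
  case (Suc j)
  then show ?case
    using assms(1,2) mu_search_eq_0[of v j] by (auto simp: mu_search_simps less_Suc_eq)
qed simp

text \<open>
  The value \<open>Suc y\<close> means that the computation halts with result \<open>y\<close> while querying the oracle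
  and minimizing only below \<open>t\<close>; the value \<open>0\<close> means that it does not.
\<close>

fun bounded_eval :: "(nat \<Rightarrow> nat) \<Rightarrow> nat \<Rightarrow> prog \<Rightarrow> nat list \<Rightarrow> nat" where
  "bounded_eval h t Zero xs = 1"
| "bounded_eval h t Succ xs = (if length xs = 1 then Suc (Suc (xs ! 0)) else 0)"
| "bounded_eval h t (Proj i) xs = (if i < length xs then Suc (xs ! i) else 0)"
| "bounded_eval h t Oracle xs =
    (if length xs = 1 then if Suc (xs ! 0) - t = 0 then Suc (h (xs ! 0)) else 0 else 0)"
| "bounded_eval h t (Comp p qs) xs =
    (if prod_list (map (\<lambda>q. bounded_eval h t q xs) qs) = 0 then 0
     else bounded_eval h t p (map (\<lambda>q. bounded_eval h t q xs - 1) qs))"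
| "bounded_eval h t (PrimRec p q) xs = (case xs of [] \<Rightarrow> 0 | n # ys \<Rightarrow>
    rec_nat (bounded_eval h t p ys)
      (\<lambda>m z. if z = 0 then 0 else bounded_eval h t q (m # (z - 1) # ys)) n)"
| "bounded_eval h t (Mu p) xs = mu_search (\<lambda>j. bounded_eval h t p (j # xs)) t - 1"

text \<open>No query reaches \<open>t\<close>, so every oracle that agrees with \<open>h\<close>
  below \<open>t\<close> yields the same computation.\<close>

lemma bounded_eval_sound:
  assumes "bounded_eval h t p xs = Suc y" and "\<And>i. i < t \<Longrightarrow> h' i = h i"
  shows "eval h' p xs y"
  using assms(1)
proof (induction p arbitrary: xs y)
  case Zero
  then show ?case by (auto intro: eval.intros)
next
  case Succ
  then show ?case by (auto simp: length_Suc_conv split: if_splits intro: eval.intros)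
next
  case (Proj i)
  then show ?case by (auto split: if_splits intro: eval.intros)
next
  case Oracle
  then obtain x where "xs = [x]" "x < t" "y = h x"
    by (auto simp: length_Suc_conv split: if_splits)
  then show ?case using eval_Oracle[of h' x] assms(2) by simp
next
  case (Comp p qs)
  have nz: "bounded_eval h t q xs \<noteq> 0" if "q \<in> set qs" for q
    using Comp.prems that by (auto simp: prod_list_zero_iff split: if_splits)
  show ?case
  proof (rule eval_Comp[where zs = "map (\<lambda>q. bounded_eval h t q xs - 1) qs"])
    show "list_all2 (\<lambda>q. eval h' q xs) qs (map (\<lambda>q. bounded_eval h t q xs - 1) qs)"
      using nz Comp.IH(2) by (auto simp: list_all2_conv_all_nth)
    show "eval h' p (map (\<lambda>q. bounded_eval h t q xs - 1) qs) y"
      using Comp.prems by (intro Comp.IH(1)) (auto split: if_splits)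
  qed
next
  case (PrimRec p q)
  then obtain n ys where xs: "xs = n # ys" by (cases xs) auto
  have "bounded_eval h t (PrimRec p q) (n # ys) = Suc y \<Longrightarrow> eval h' (PrimRec p q) (n # ys) y" for y
  proof (induction n arbitrary: y)
    case 0
    then show ?case using PrimRec.IH(1) by (auto intro: eval.intros)
  next
    case (Suc n)
    let ?z = "bounded_eval h t (PrimRec p q) (n # ys)"
    have nz: "?z \<noteq> 0" and y: "bounded_eval h t q (n # (?z - 1) # ys) = Suc y"
      using Suc.prems by (auto split: if_splits)
    have "eval h' (PrimRec p q) (n # ys) (?z - 1)" using nz by (intro Suc.IH) simp
    moreover have "eval h' q (n # (?z - 1) # ys) y" using y by (rule PrimRec.IH(2))
    ultimately show ?case by (rule eval_PrimRec_Suc)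
  qed
  then show ?case using PrimRec.prems xs by blast
next
  case (Mu p)
  let ?v = "\<lambda>j. bounded_eval h t p (j # xs)"
  have "mu_search ?v t = Suc (Suc y)" using Mu.prems by simp
  then have v: "?v y = 1" "\<And>i. i < y \<Longrightarrow> ?v i > 1" using mu_search_sound by blast+
  show ?case
  proof (rule eval_Mu)
    show "eval h' p (y # xs) 0" using v(1) by (intro Mu.IH) simp
    show "\<forall>i<y. \<exists>z. eval h' p (i # xs) (Suc z)"
    proof (intro allI impI)
      fix i assume "i < y"
      then have "?v i = Suc (Suc (?v i - 2))" using v(2)[of i] by simp
      then show "\<exists>z. eval h' p (i # xs) (Suc z)" using Mu.IH by blast
    qed
  qed
qed

text \<open>A halting computation is finite, so one \<open>t0\<close> bounds its queries and its
  searches. With soundness this makes \<open>eval\<close> continuous in the oracle.\<close>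

lemma bounded_eval_complete:
  assumes "eval h p xs y"
  shows "\<exists>t0. \<forall>t\<ge>t0. \<forall>h'. (\<forall>i<t0. h' i = h i) \<longrightarrow> bounded_eval h' t p xs = Suc y"
  using assms
proof (induction rule: eval.induct)
  case (eval_Oracle x)
  then show ?case by (intro exI[of _ "Suc x"]) auto
next
  case (eval_Comp xs qs zs p y)
  obtain t0 where t0: "\<And>t h'. t \<ge> t0 \<Longrightarrow> \<forall>i<t0. h' i = h i \<Longrightarrow> bounded_eval h' t p zs = Suc y"
    using eval_Comp.IH(2) by blast
  have "\<exists>t1. \<forall>t\<ge>t1. \<forall>h'. (\<forall>i<t1. h' i = h i) \<longrightarrow> map (\<lambda>q. bounded_eval h' t q xs) qs = map Suc zs"
    using eval_Comp.IH(1)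
  proof (induction rule: list_all2_induct)
    case (Cons q qs z zs)
    obtain a where a: "\<And>t h'. t \<ge> a \<Longrightarrow> \<forall>i<a. h' i = h i \<Longrightarrow> bounded_eval h' t q xs = Suc z"
      using Cons(1) by blast
    obtain b where b: "\<And>t h'. t \<ge> b \<Longrightarrow> \<forall>i<b. h' i = h i \<Longrightarrow>
        map (\<lambda>q. bounded_eval h' t q xs) qs = map Suc zs"
      using Cons(3) by blast
    show ?case using a b by (intro exI[of _ "max a b"]) auto
  qed simp
  then obtain t1 where t1: "\<And>t h'. t \<ge> t1 \<Longrightarrow> \<forall>i<t1. h' i = h i \<Longrightarrow>
      map (\<lambda>q. bounded_eval h' t q xs) qs = map Suc zs"
    by blast
  show ?case
  proof (intro exI[of _ "max t0 t1"] allI impI)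
    fix t h' assume t: "max t0 t1 \<le> t" and h': "\<forall>i<max t0 t1. h' i = h i"
    have m: "map (\<lambda>q. bounded_eval h' t q xs) qs = map Suc zs" using t1 t h' by simp
    have "map (\<lambda>q. bounded_eval h' t q xs - 1) qs
        = map (\<lambda>z. z - 1) (map (\<lambda>q. bounded_eval h' t q xs) qs)"
      by simp
    also have "\<dots> = zs" unfolding m by (simp add: comp_def)
    finally have m': "map (\<lambda>q. bounded_eval h' t q xs - 1) qs = zs" .
    have "prod_list (map (\<lambda>q. bounded_eval h' t q xs) qs) \<noteq> 0"
      unfolding m by (auto simp: prod_list_zero_iff)
    then show "bounded_eval h' t (Comp p qs) xs = Suc y"
      unfolding bounded_eval.simps m' using t0 t h' by simp
  qed
next
  case (eval_PrimRec_Suc p q n xs z y)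
  obtain a where a: "\<And>t h'. t \<ge> a \<Longrightarrow> \<forall>i<a. h' i = h i \<Longrightarrow>
      bounded_eval h' t (PrimRec p q) (n # xs) = Suc z"
    using eval_PrimRec_Suc.IH(1) by blast
  obtain b where b: "\<And>t h'. t \<ge> b \<Longrightarrow> \<forall>i<b. h' i = h i \<Longrightarrow>
      bounded_eval h' t q (n # z # xs) = Suc y"
    using eval_PrimRec_Suc.IH(2) by blast
  show ?case using a b by (intro exI[of _ "max a b"]) auto
next
  case (eval_Mu p y xs)
  obtain a where a: "\<And>t h'. t \<ge> a \<Longrightarrow> \<forall>i<a. h' i = h i \<Longrightarrow> bounded_eval h' t p (y # xs) = Suc 0"
    using eval_Mu.IH(1) by blast
  have "\<forall>j. \<exists>b. j < y \<longrightarrow> (\<forall>t\<ge>b. \<forall>h'. (\<forall>i<b. h' i = h i) \<longrightarrow> bounded_eval h' t p (j # xs) > 1)"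
  proof (intro allI)
    fix j
    show "\<exists>b. j < y \<longrightarrow> (\<forall>t\<ge>b. \<forall>h'. (\<forall>i<b. h' i = h i) \<longrightarrow> bounded_eval h' t p (j # xs) > 1)"
    proof (cases "j < y")
      case True
      then obtain z b where "\<forall>t\<ge>b. \<forall>h'. (\<forall>i<b. h' i = h i) \<longrightarrow>
          bounded_eval h' t p (j # xs) = Suc (Suc z)"
        using eval_Mu.IH(2) by blast
      then show ?thesis by (intro exI[of _ b]) simp
    qed simp
  qed
  then obtain b where b: "\<And>j t h'. j < y \<Longrightarrow> t \<ge> b j \<Longrightarrow> \<forall>i<b j. h' i = h i \<Longrightarrow>
      bounded_eval h' t p (j # xs) > 1"
    by metis
  \<comment> \<open>The sum dominates each \<open>b j\<close> with \<open>j < y\<close>, and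
    \<open>Suc y\<close> lets the search reach \<open>y\<close>.\<close>
  define t0 where "t0 = Suc y + a + sum b {..<y}"
  have bt: "b j \<le> t0" if "j < y" for j
    using member_le_sum[of j "{..<y}" b] that unfolding t0_def by simp
  show ?case
  proof (intro exI[of _ t0] allI impI)
    fix t h' assume t: "t0 \<le> t" and h': "\<forall>i<t0. h' i = h i"
    have "mu_search (\<lambda>j. bounded_eval h' t p (j # xs)) t = Suc (Suc y)"
    proof (rule mu_search_complete)
      show "bounded_eval h' t p (y # xs) = 1" using a[of t h'] t h' by (auto simp: t0_def)
      show "bounded_eval h' t p (i # xs) > 1" if "i < y" for i
        using b[OF that, of t h'] bt[OF that] t h' by auto
      show "y < t" using t by (simp add: t0_def)
    qed
    then show "bounded_eval h' t (Mu p) xs = Suc y" by simp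
  qed
qed auto

section \<open>Recursiveness of bounded evaluation\<close>

lemma recf_prod_list:
  "(\<And>q. q \<in> set qs \<Longrightarrow> recf k (f q)) \<Longrightarrow> recf k (\<lambda>xs. prod_list (map (\<lambda>q. f q xs) qs))"
  by (induction qs) (auto intro: recf_const recf_mult)

text \<open>The time bound also indexes the oracle, so a single number presents a finite string and
  the time allowed on it. The induction keeps \<open>k\<close> arbitrary because subprograms run at
  other arities.\<close>

lemma recf_bounded_eval:
  assumes d: "\<And>k F G. recf k F \<Longrightarrow> recf k G \<Longrightarrow> recf k (\<lambda>xs. d (F xs) (G xs))"
  shows "recf (Suc k) (\<lambda>ys. bounded_eval (d (ys ! 0)) (ys ! 0) p (drop 1 ys))"
proof (induction p arbitrary: k)
  case Zero
  show ?case by (simp add: recf_const)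
next
  case Succ
  show ?case
  proof (cases "k = 1")
    case True
    have "recf (Suc k) (\<lambda>ys. Suc (Suc (ys ! 1)))" using True by (intro recf_Suc recf_nth) simp
    then show ?thesis by (rule recf_cong) (simp add: True)
  next
    case False
    show ?thesis by (rule recf_cong[OF recf_zero]) (use False in simp)
  qed
next
  case (Proj i)
  show ?case
  proof (cases "i < k")
    case True
    have "recf (Suc k) (\<lambda>ys. Suc (ys ! Suc i))" using True by (intro recf_Suc recf_nth) simp
    then show ?thesis by (rule recf_cong) (simp add: True)
  next
    case False
    show ?thesis by (rule recf_cong[OF recf_zero]) (use False in simp)
  qed
next
  case Oracle
  show ?case
  proof (cases "k = 1")
    case True
    have "recf (Suc k) (\<lambda>ys. if Suc (ys ! 1) - ys ! 0 = 0 then Suc (d (ys ! 0) (ys ! 1)) else 0)"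
      using True by (intro recf_if_zero recf_Suc recf_diff recf_zero d recf_nth) auto
    then show ?thesis by (rule recf_cong) (simp add: True)
  next
    case False
    show ?thesis by (rule recf_cong[OF recf_zero]) (use False in simp)
  qed
next
  case (Comp p qs)
  let ?f = "\<lambda>q ys. bounded_eval (d (ys ! 0)) (ys ! 0) q (drop 1 ys)"
  let ?Gs = "(\<lambda>ys. ys ! 0) # map (\<lambda>q ys. ?f q ys - 1) qs"
  have "recf (Suc k) (\<lambda>ys. ?f p (map (\<lambda>G. G ys) ?Gs))"
    using Comp.IH by (intro recf_subst) (auto intro!: recf_nth recf_pred simp del: One_nat_def)
  moreover have "recf (Suc k) (\<lambda>ys. prod_list (map (\<lambda>q. ?f q ys) qs))"
    using Comp.IH(2) by (intro recf_prod_list)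
  ultimately have "recf (Suc k) (\<lambda>ys. if prod_list (map (\<lambda>q. ?f q ys) qs) = 0 then 0
      else ?f p (map (\<lambda>G. G ys) ?Gs))"
    by (intro recf_if_zero recf_zero)
  then show ?case by (rule recf_cong) (simp add: comp_def)
next
  case (PrimRec p q)
  show ?case
  proof (cases k)
    case 0
    then show ?thesis by (intro recf_cong[OF recf_zero]) auto
  next
    case (Suc l)
    let ?P = "\<lambda>ys. bounded_eval (d (ys ! 0)) (ys ! 0) p (drop 1 ys)"
    let ?Q = "\<lambda>ys. bounded_eval (d (ys ! 0)) (ys ! 0) q (drop 1 ys)"
    \<comment> \<open>Here entry \<open>0\<close> is the time bound, entry \<open>1\<close> the
      recursion argument, and the parameters follow.\<close>
    have P: "recf (2 + l) (\<lambda>ys. ?P (map (\<lambda>G. G ys) [\<lambda>ys. ys ! 0] @ drop 2 ys))"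
      using PrimRec.IH(1) by (intro recf_subst_drop) (auto intro: recf_nth)
    \<comment> \<open>Inside the recursion the counter and the shifted previous value come first,
      which moves the bound to entry \<open>2\<close>.\<close>
    have Q: "recf (4 + l) (\<lambda>ys. ?Q (map (\<lambda>G. G ys)
        [\<lambda>ys. ys ! 2, \<lambda>ys. ys ! 0, \<lambda>ys. ys ! 1 - 1] @ drop 4 ys))"
      using PrimRec.IH(2)[of "Suc (Suc l)"]
      by (intro recf_subst_drop) (auto intro!: recf_nth recf_pred simp: numeral_3_eq_3 simp del: One_nat_def)
    have "recf (2 + l) (\<lambda>ys. rec_nat (?P (ys ! 0 # drop 2 ys))
       (\<lambda>m z. if z = 0 then 0 else ?Q (ys ! 0 # m # (z - 1) # drop 2 ys)) (ys ! 1))"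
    proof (rule recf_rec_nat)
      show "recf (2 + l) (\<lambda>ys. ?P (ys ! 0 # drop 2 ys))" using P by simp
      show "recf (2 + l) (\<lambda>ys. ys ! 1)" by (simp add: recf_nth)
      have "recf (4 + l) (\<lambda>ys. if ys ! 1 = 0 then 0
          else ?Q (ys ! 2 # ys ! 0 # (ys ! 1 - 1) # drop 4 ys))"
        using Q by (intro recf_if_zero recf_nth recf_zero) auto
      moreover have "4 + l = 2 + (2 + l)" by simp
      ultimately have "recf (2 + (2 + l)) (\<lambda>ys. if ys ! 1 = 0 then 0
          else ?Q (ys ! 2 # ys ! 0 # (ys ! 1 - 1) # drop 4 ys))"
        by metis
      then show "recf (2 + (2 + l)) (\<lambda>ys. if ys ! 1 = 0 then 0
          else ?Q (drop 2 ys ! 0 # ys ! 0 # (ys ! 1 - 1) # drop 2 (drop 2 ys)))"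
        by (rule recf_cong) simp
    qed
    then have "recf (Suc k) (\<lambda>ys. rec_nat (?P (ys ! 0 # drop 2 ys))
       (\<lambda>m z. if z = 0 then 0 else ?Q (ys ! 0 # m # (z - 1) # drop 2 ys)) (ys ! 1))"
      using Suc by simp
    then show ?thesis
      by (rule recf_cong) (auto simp: Suc length_Suc_conv cong: if_cong)
  qed
next
  case (Mu p)
  let ?P = "\<lambda>ys. bounded_eval (d (ys ! 0)) (ys ! 0) p (drop 1 ys)"
  \<comment> \<open>The search puts its counter and its state in front, so the bound is entry
    \<open>2\<close> and the inputs start at \<open>3\<close>.\<close>
  have P: "recf (3 + k) (\<lambda>ys. ?P (map (\<lambda>G. G ys) [\<lambda>ys. ys ! 2, \<lambda>ys. ys ! 0] @ drop 3 ys))"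
    using Mu.IH[of "Suc k"] by (intro recf_subst_drop) (auto intro: recf_nth)
  have P': "recf (2 + Suc k) (\<lambda>ys. ?P (drop 2 ys ! 0 # ys ! 0 # drop 1 (drop 2 ys)))"
  proof -
    have eq: "2 + Suc k = 3 + k" by simp
    show ?thesis unfolding eq
      by (rule recf_cong[OF P]) (simp add: numeral_2_eq_2 numeral_3_eq_3)
  qed
  have "recf (Suc k) (\<lambda>ys. mu_search (\<lambda>j. ?P (ys ! 0 # j # drop 1 ys)) (ys ! 0) - 1)"
    unfolding mu_search_def
    by (intro recf_pred recf_rec_nat recf_zero recf_nth recf_if_zero P' recf_const recf_Suc) auto
  then show ?case by simp
qed


section \<open>A recursive oracle with total image\<close>

text \<open>Every finite string over \<open>range u\<close> extends to one on which \<open>p\<close>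
  halts at \<open>n\<close>, and such an extension can be searched for recursively. Doing so for
  \<open>n = 0, 1, ...\<close> in turn builds \<open>f\<close> as the limit of the strings.\<close>

lemma recursive_oracle_from_dense_convergence:
  assumes u: "recursive_function u"
    and dense: "\<And>h m n. range h \<subseteq> range u \<Longrightarrow>
      \<exists>h' y. range h' \<subseteq> range u \<and> (\<forall>i<m. h' i = h i) \<and> eval h' p [n] y"
  obtains f where "recursive_function f" and "range f \<subseteq> range u" and "\<And>n. \<exists>y. eval f p [n] y"
proof -
  \<comment> \<open>A number \<open>c\<close> codes the string \<open>d c 0, \<dots>, d c (c - 1)\<close>, so that it also serves as the bound
    for queries and for minimization.\<close>
  define d where "d c i = u (seq_nth c i)" for c i
  have d_surj: "\<exists>c\<ge>t. \<forall>i<m. d c i = h i" if "range h \<subseteq> range u" for h t m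
  proof -
    have "\<forall>i. \<exists>j. u j = h i" using that by (metis rangeI rangeE subsetD)
    then obtain w where "\<And>i. u (w i) = h i" by metis
    then show ?thesis using seq_nth_surj[of t m w] unfolding d_def by metis
  qed
  have recf_d: "recf k (\<lambda>xs. d (F xs) (G xs))" if "recf k F" "recf k G" for k F G
    unfolding d_def by (intro recf_recursive_function[OF u] recf_seq_nth that)
  \<comment> \<open>Each summand vanishes iff one requirement on \<open>c'\<close> holds; adding
    both truncated differences expresses equality.\<close>
  define test where "test n c c' = (Suc c - c') + (\<Sum>i<c. (d c' i - d c i) + (d c i - d c' i))
      + (1 - bounded_eval (d c') c' p [n])" for n c c'
  have test_iff: "test n c c' = 0 \<longleftrightarrow>
      c < c' \<and> (\<forall>i<c. d c' i = d c i) \<and> bounded_eval (d c') c' p [n] \<noteq> 0" for n c c'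
    by (auto simp: test_def intro: le_antisym)
  define step where "step n c = (LEAST c'. test n c c' = 0)" for n c
  have test_ex: "\<exists>c'. test n c c' = 0" for n c
  proof -
    \<comment> \<open>The hypothesis speaks of total oracles, so the string is continued by the
      remaining values of \<open>d c\<close>.\<close>
    have "range (d c) \<subseteq> range u" by (auto simp: d_def)
    from dense[OF this] obtain h y
      where h: "range h \<subseteq> range u" "\<forall>i<c. h i = d c i" "eval h p [n] y" by blast
    from bounded_eval_complete[OF h(3)] obtain t0
      where t0: "\<And>t h'. t \<ge> t0 \<Longrightarrow> \<forall>i<t0. h' i = h i \<Longrightarrow> bounded_eval h' t p [n] = Suc y" by blast
    \<comment> \<open>The new string must contain the part of \<open>h\<close> that the computation
      uses and be longer than the old one.\<close>
    obtain c' where c': "c' \<ge> max t0 (Suc c)" "\<And>i. i < max t0 (Suc c) \<Longrightarrow> d c' i = h i"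
      using d_surj[OF h(1)] by blast
    then have "test n c c' = 0" using h(2) t0[of c' "d c'"] by (auto simp: test_iff)
    then show ?thesis ..
  qed
  then have test_step: "test n c (step n c) = 0" for n c
    unfolding step_def by (rule LeastI_ex)
  have recf_step: "recf 2 (\<lambda>xs. step (xs ! 0) (xs ! 1))"
    unfolding step_def
  proof (rule recf_Least)
    let ?F = "\<lambda>ys. bounded_eval (d (ys ! 0)) (ys ! 0) p (drop 1 ys)"
    have F: "recf (Suc 1) ?F" by (rule recf_bounded_eval) (rule recf_d)
    have "recf (Suc 2) (\<lambda>ys. ?F (map (\<lambda>G. G ys) [\<lambda>ys. ys ! 0, \<lambda>ys. drop 1 ys ! 0]))"
      by (rule recf_subst) (use F in \<open>auto intro!: recf_nth recf_nth_drop\<close>)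
    then have B: "recf (Suc 2) (\<lambda>ys. bounded_eval (d (ys ! 0)) (ys ! 0) p [drop 1 ys ! 0])"
      by simp
    show "recf (Suc 2) (\<lambda>ys. test (drop 1 ys ! 0) (drop 1 ys ! 1) (ys ! 0))"
      unfolding test_def
      by (intro recf_add recf_sum recf_diff recf_const recf_Suc recf_d B)
        (auto intro!: recf_nth recf_nth_drop)
    show "\<exists>y. test (xs ! 0) (xs ! 1) y = 0" for xs :: "nat list" by (rule test_ex)
  qed
  define C where "C = rec_nat 0 step"
  \<comment> \<open>By stage \<open>Suc i\<close> the string has length above \<open>i\<close>, as
    \<open>C_ge\<close> shows.\<close>
  define f where "f i = d (C (Suc i)) i" for i
  have C_Suc: "C (Suc n) = step n (C n)" for n by (simp add: C_def)
  have C_less: "C n < C (Suc n)" and C_agree: "i < C n \<Longrightarrow> d (C (Suc n)) i = d (C n) i"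
    and C_halt: "bounded_eval (d (C (Suc n))) (C (Suc n)) p [n] \<noteq> 0" for n i
    using test_step[of n "C n"] by (auto simp: test_iff C_Suc)
  have C_ge: "n \<le> C n" for n
    by (induction n) (use C_less in \<open>auto intro: Suc_leI le_less_trans\<close>)
  have agree: "d (C m) i = d (C n) i" if "n \<le> m" "i < C n" for m n i
    using that
  proof (induction m rule: dec_induct)
    case (step m)
    have "C n \<le> C m" using step(1) C_less by (meson lift_Suc_mono_le less_imp_le)
    then show ?case using step C_agree[of i m] by simp
  qed simp
  have f_agree: "f i = d (C n) i" if "i < C n" for n i
  proof (cases "n \<le> Suc i")
    case True
    then show ?thesis using agree that by (simp add: f_def)
  next
    case False
    then show ?thesis using agree[of "Suc i" n i] C_ge[of "Suc i"] by (simp add: f_def)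
  qed
  show ?thesis
  proof
    have "recf (2 + 1) (\<lambda>ys. step (ys ! 0) (ys ! 1))"
      using recf_subst[of "[\<lambda>ys. ys ! 0, \<lambda>ys. ys ! 1]" "\<lambda>xs. step (xs ! 0) (xs ! 1)" "2 + 1"] recf_step
      by (auto simp: numeral_2_eq_2 intro: recf_nth)
    then have "recf 1 (\<lambda>xs. d (rec_nat 0 (\<lambda>n c. step n c) (Suc (xs ! 0))) (xs ! 0))"
      by (intro recf_d recf_rec_nat recf_zero recf_Suc recf_nth) auto
    then show "recursive_function f" by (simp add: recursive_function_iff_recf f_def C_def)
    show "range f \<subseteq> range u" by (auto simp: f_def d_def)
    show "\<exists>y. eval f p [n] y" for n
    proof -
      obtain y where "bounded_eval (d (C (Suc n))) (C (Suc n)) p [n] = Suc y"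
        using C_halt not0_implies_Suc by blast
      then have "eval f p [n] y" by (rule bounded_eval_sound) (rule f_agree)
      then show ?thesis ..
    qed
  qed
qed

section \<open>Medvedev reducibility\<close>

fun oracle_subst :: "prog \<Rightarrow> prog \<Rightarrow> prog" where
  "oracle_subst q Zero = Zero"
| "oracle_subst q Succ = Succ"
| "oracle_subst q (Proj i) = Proj i"
| "oracle_subst q Oracle = q"
| "oracle_subst q (Comp p ps) = Comp (oracle_subst q p) (map (oracle_subst q) ps)"
| "oracle_subst q (PrimRec p r) = PrimRec (oracle_subst q p) (oracle_subst q r)"
| "oracle_subst q (Mu p) = Mu (oracle_subst q p)"

text \<open>With an oracle-free \<open>q\<close> this gives recursive images of recursive functions;
  with a functional as \<open>q\<close> it composes reductions.\<close>

lemma eval_oracle_subst: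
  assumes "eval h p xs y" and q: "\<And>x. eval h' q [x] (h x)"
  shows "eval h' (oracle_subst q p) xs y"
  using assms(1)
proof (induction rule: eval.induct)
  case (eval_Comp xs qs zs p y)
  then show ?case
    by (auto intro!: eval.eval_Comp[where zs = zs] simp: list_all2_conv_all_nth)
next
  case (eval_Mu p y xs)
  then show ?case by (auto intro!: eval.eval_Mu)
qed (auto intro: eval.intros q)

lemma oracle_free_oracle_subst: "oracle_free q \<Longrightarrow> oracle_free (oracle_subst q p)"
  by (induction p) auto

lemma recursive_function_functional_maps:
  assumes "recursive_function f" and "functional_maps p f g"
  shows "recursive_function g"
proof -
  obtain q where q: "oracle_free q" "\<And>n. eval (\<lambda>_. 0) q [n] (f n)"
    using assms(1) unfolding recursive_function_def by blast
  show ?thesis unfolding recursive_function_def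
    using q eval_oracle_subst[OF _ q(2)] assms(2) oracle_free_oracle_subst[OF q(1), of p]
    unfolding functional_maps_def by blast
qed

lemma medvedev_le_refl: "\<A> \<le>\<^sub>s \<A>"
  unfolding medvedev_le_def functional_maps_def by (auto intro: eval_Oracle)

lemma medvedev_le_trans:
  assumes "\<A> \<le>\<^sub>s \<B>" and "\<B> \<le>\<^sub>s \<C>"
  shows "\<A> \<le>\<^sub>s \<C>"
proof -
  obtain p where p: "\<And>f. f \<in> \<B> \<Longrightarrow> \<exists>g\<in>\<A>. functional_maps p f g"
    using assms(1) unfolding medvedev_le_def by blast
  obtain q where q: "\<And>f. f \<in> \<C> \<Longrightarrow> \<exists>g\<in>\<B>. functional_maps q f g"
    using assms(2) unfolding medvedev_le_def by blast
  have "\<exists>g\<in>\<A>. functional_maps (oracle_subst q p) f g" if "f \<in> \<C>" for f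
    using q[OF that] p eval_oracle_subst unfolding functional_maps_def by metis
  then show ?thesis unfolding medvedev_le_def by blast
qed

lemma has_recursive_member_medvedev_le:
  assumes "\<A> \<le>\<^sub>s \<B>" and "has_recursive_member \<B>"
  shows "has_recursive_member \<A>"
  using assms recursive_function_functional_maps
  unfolding medvedev_le_def has_recursive_member_def by blast

section \<open>Closed sets of Baire space and enumerations\<close>

text \<open>A basic open set restricts finitely many coordinates, so a point outside
  \<open>C\<close> has an initial segment that no member of \<open>C\<close> shares.\<close>

lemma closed_member_if_approximable:
  fixes C :: "(nat \<Rightarrow> nat) set"
  assumes "closed C" and "\<And>N. \<exists>g'\<in>C. \<forall>n<N. g' n = g n"
  shows "g \<in> C"
proof -
  have "\<exists>N. \<forall>g'. (\<forall>n<N. g' n = g n) \<longrightarrow> g' \<in> - C" if "g \<notin> C"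
  proof -
    have "openin (product_topology (\<lambda>_. euclidean) UNIV) (- C)"
      using assms(1) by (metis open_Compl open_fun_def)
    from product_topology_open_contains_basis[OF this, of g] that obtain X
      where X: "g \<in> (\<Pi>\<^sub>E i\<in>UNIV. X i)" "finite {i. X i \<noteq> UNIV}" "(\<Pi>\<^sub>E i\<in>UNIV. X i) \<subseteq> - C"
      by auto
    obtain N where N: "\<And>i. X i \<noteq> UNIV \<Longrightarrow> i < N"
      using X(2) finite_nat_set_iff_bounded[of "{i. X i \<noteq> UNIV}"] by blast
    have "g' \<in> - C" if "\<forall>n<N. g' n = g n" for g'
    proof -
      have "g' n \<in> X n" for n using N[of n] that X(1) by (cases "n < N") (auto simp: PiE_iff)
      then show ?thesis using X(3) by (auto simp: PiE_iff)
    qed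
    then show ?thesis by blast
  qed
  then show ?thesis using assms(2) by blast
qed

text \<open>Enumerations of \<open>A\<close> are dense among the functions into \<open>A\<close>: a
  listing of \<open>A\<close> is appended to the given string.\<close>

lemma enumeration_extending:
  fixes A :: "nat set"
  assumes "A \<noteq> {}" and "\<And>i. i < m \<Longrightarrow> h i \<in> A"
  obtains f where "f \<in> enumerations A" and "\<And>i. i < m \<Longrightarrow> f i = h i"
proof
  let ?f = "\<lambda>i. if i < m then h i else from_nat_into A (i - m)"
  have "A \<subseteq> range ?f"
  proof
    fix a assume "a \<in> A"
    then obtain j where "a = from_nat_into A j"
      using from_nat_into_surj[of A a] by (metis countableI_type)
    then show "a \<in> range ?f" by (intro image_eqI[of _ _ "m + j"]) auto
  qed
  then show "?f \<in> enumerations A"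
    using assms from_nat_into[OF assms(1)] by (auto simp: enumerations_def)
qed auto

lemma closed_has_recursive_member_if_total_on_recursive:
  assumes "closed C" and red: "\<And>f. f \<in> enumerations A \<Longrightarrow> \<exists>g\<in>C. functional_maps p f g"
    and f: "recursive_function f" "range f \<subseteq> A" and total: "\<And>n. \<exists>y. eval f p [n] y"
  shows "has_recursive_member C"
proof -
  obtain g where g: "\<And>n. eval f p [n] (g n)" using total by metis
  have "\<exists>g'\<in>C. \<forall>n<N. g' n = g n" for N
  proof -
    \<comment> \<open>Continuity: the value at \<open>n\<close> depends only on \<open>f\<close>
      below some \<open>t\<close>.\<close>
    have "\<forall>n. \<exists>t. \<forall>h'. (\<forall>i<t. h' i = f i) \<longrightarrow> eval h' p [n] (g n)"
      using bounded_eval_complete[OF g] bounded_eval_sound by (metis order_refl)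
    then obtain t where t: "\<And>n h'. \<forall>i<t n. h' i = f i \<Longrightarrow> eval h' p [n] (g n)" by metis
    \<comment> \<open>The sum bounds all uses for \<open>n < N\<close>, so a single enumeration
      \<open>e\<close> serves them together.\<close>
    have le: "t n \<le> sum t {..<N}" if "n < N" for n
      using member_le_sum[of n "{..<N}" t] that by simp
    obtain e where e: "e \<in> enumerations A" "\<And>i. i < sum t {..<N} \<Longrightarrow> e i = f i"
      using enumeration_extending[of A "sum t {..<N}" f] f(2) by blast
    obtain g' where g': "g' \<in> C" "\<And>n. eval e p [n] (g' n)"
      using red[OF e(1)] unfolding functional_maps_def by blast
    have "g' n = g n" if "n < N" for n
      using t[of n e] e(2) le[OF that] g'(2) eval_deterministic by (meson order_less_le_trans)
    then show ?thesis using g'(1) by blast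
  qed
  then have "g \<in> C" using closed_member_if_approximable assms(1) by blast
  moreover have "recursive_function g"
    using recursive_function_functional_maps[OF f(1)] g unfolding functional_maps_def by blast
  ultimately show ?thesis unfolding has_recursive_member_def by blast
qed

section \<open>Recursively enumerable sets\<close>

text \<open>Ranges of total functions are nonempty, so the empty set is excluded.\<close>

definition ce :: "nat set \<Rightarrow> bool" where
  "ce R \<longleftrightarrow> has_recursive_member (enumerations R)"

lemma ce_iff: "ce R \<longleftrightarrow> (\<exists>u. recursive_function u \<and> range u = R)"
  by (auto simp: ce_def has_recursive_member_def enumerations_def)

lemma ce_insert_empty: "ce {x}"
  using recf_const[of 1 x] by (auto simp: ce_iff recursive_function_iff_recf intro!: exI[of _ "\<lambda>_. x"])

lemma ce_Un:
  assumes "ce R" and "ce S"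
  shows "ce (R \<union> S)"
proof -
  obtain a b where ab: "recursive_function a" "range a = R" "recursive_function b" "range b = S"
    using assms unfolding ce_iff by blast
  let ?e = "\<lambda>c. if unpair1 c = 0 then a (unpair2 c) else b (unpair2 c)"
  have "recursive_function ?e"
    unfolding recursive_function_iff_recf
    by (intro recf_if_zero recf_recursive_function[OF ab(1)] recf_recursive_function[OF ab(3)]
        recf_unpair1 recf_unpair2 recf_nth) auto
  moreover have "a n \<in> range ?e \<and> b n \<in> range ?e" for n
  proof -
    obtain c c' where "unpair1 c = 0" "unpair2 c = n" "unpair1 c' = 1" "unpair2 c' = n"
      using unpair_surj by metis
    then have "a n = ?e c" "b n = ?e c'" by simp_all
    then show ?thesis using range_eqI[of "a n" ?e c] range_eqI[of "b n" ?e c'] by blast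
  qed
  then have "range ?e = R \<union> S" using ab by auto
  ultimately show ?thesis unfolding ce_iff by blast
qed

lemma ce_Un_finite: "finite S \<Longrightarrow> ce R \<Longrightarrow> ce (R \<union> S)"
proof (induction S rule: finite_induct)
  case (insert x S)
  then show ?case using ce_Un[OF _ ce_insert_empty[of x], of "R \<union> S"] by simp
qed simp

lemma recursive_function_affine: "recursive_function (\<lambda>n. a * n + b)"
  unfolding recursive_function_iff_recf by (intro recf_add recf_mult recf_const recf_nth) simp

section \<open>The forcing construction\<close>

text \<open>Injectivity keeps infinitely many elements undecided and lets subsequences of
  \<open>v\<close> split them into disjoint parts.\<close>

definition condition :: "nat set \<times> (nat \<Rightarrow> nat) \<Rightarrow> bool" where
  "condition = (\<lambda>(R, v). ce R \<and> recursive_function v \<and> inj v \<and> R \<inter> range v = {})"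

definition realizes :: "nat set \<times> (nat \<Rightarrow> nat) \<Rightarrow> nat set \<Rightarrow> bool" where
  "realizes = (\<lambda>(R, v) A. R \<subseteq> A \<and> A \<subseteq> R \<union> range v)"

definition extends :: "nat set \<times> (nat \<Rightarrow> nat) \<Rightarrow> nat set \<times> (nat \<Rightarrow> nat) \<Rightarrow> bool" where
  "extends = (\<lambda>(R', v') (R, v). R \<subseteq> R' \<and> R' \<union> range v' \<subseteq> R \<union> range v)"

lemma extends_refl: "extends c c"
  by (auto simp: extends_def split: prod.split)

lemma extends_trans: "extends c b \<Longrightarrow> extends b a \<Longrightarrow> extends c a"
  unfolding extends_def case_prod_beta by (meson order_trans)

lemma realizes_extends: "extends c b \<Longrightarrow> realizes c A \<Longrightarrow> realizes b A"
  unfolding extends_def realizes_def case_prod_beta by (meson Un_upper1 le_sup_iff order_trans)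

text \<open>The element \<open>v 0\<close> is decided against \<open>g\<close>: it is kept out of
  \<open>A\<close> if \<open>g\<close> takes this value and put into \<open>A\<close> otherwise. The
  function \<open>g\<close> is arbitrary.\<close>

lemma force_not_range:
  assumes "condition c"
  obtains c' where "condition c'" and "extends c' c" and "\<And>A. realizes c' A \<Longrightarrow> A \<noteq> range g"
proof -
  obtain R v where c: "c = (R, v)" by (cases c)
  with assms have Rv: "ce R" "recursive_function v" "inj v" "R \<inter> range v = {}"
    by (auto simp: condition_def)
  let ?v = "\<lambda>n. v (Suc n)"
  have v: "recursive_function ?v" "inj ?v"
    using recursive_function_comp[OF Rv(2) recursive_function_affine[of 1 1]] Rv(3)
    by (auto simp: inj_def)
  have v0: "v 0 \<notin> range ?v" using Rv(3) by (auto simp: inj_def)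
  show ?thesis
  proof (cases "v 0 \<in> range g")
    case True
    have "v 0 \<notin> R" using Rv(4) by auto
    then have "A \<noteq> range g" if "realizes (R, ?v) A" for A
      using True v0 that by (auto simp: realizes_def)
    then show ?thesis
      using Rv v by (intro that[of "(R, ?v)"]) (auto simp: condition_def extends_def c)
  next
    case False
    then have "A \<noteq> range g" if "realizes (R \<union> {v 0}, ?v) A" for A
      using that by (auto simp: realizes_def)
    then show ?thesis
      using Rv v v0 ce_Un_finite[of "{v 0}" R]
      by (intro that[of "(R \<union> {v 0}, ?v)"]) (auto simp: condition_def extends_def c)
  qed
qed

text \<open>
  Half of the undecided elements \<open>range v\<close> are reserved. If the functional has densely convergent
  computations from enumerations avoiding the reserve, then some recursive such enumeration has a
  total image, and everything outside the reserve is put into \<open>A\<close>; otherwise a finite sequence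
  without convergent extension is put into \<open>A\<close> and the reserve is discarded.
\<close>

lemma force_closed_image:
  assumes "condition c"
  obtains c' where "condition c'" and "extends c' c"
    and "\<And>A C. realizes c' A \<Longrightarrow> closed C \<Longrightarrow>
      (\<And>f. f \<in> enumerations A \<Longrightarrow> \<exists>g\<in>C. functional_maps p f g) \<Longrightarrow> has_recursive_member C"
proof -
  obtain R v where c: "c = (R, v)" by (cases c)
  with assms have Rv: "ce R" "recursive_function v" "inj v" "R \<inter> range v = {}"
    by (auto simp: condition_def)
  have aff: "recursive_function (\<lambda>n. v (a * n + b))" for a b
    by (rule recursive_function_comp[OF Rv(2) recursive_function_affine])
  have inj: "v i = v j \<longleftrightarrow> i = j" for i j using Rv(3) by (auto simp: inj_def)
  have disj: "v i \<notin> R" for i using Rv(4) by auto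
  \<comment> \<open>The values of \<open>v\<close> at odd arguments form the reserve.\<close>
  let ?X = "R \<union> range (\<lambda>n. v (2 * n))"
  have X: "ce ?X" using ce_Un[OF Rv(1)] aff[of 2 0] ce_iff by auto
  then obtain u where u: "recursive_function u" "range u = ?X" unfolding ce_iff by blast
  show ?thesis
  proof (cases "\<forall>h m n. range h \<subseteq> range u \<longrightarrow>
      (\<exists>h' y. range h' \<subseteq> range u \<and> (\<forall>i<m. h' i = h i) \<and> eval h' p [n] y)")
    case True
    obtain f where f: "recursive_function f" "range f \<subseteq> range u" "\<And>n. \<exists>y. eval f p [n] y"
      using recursive_oracle_from_dense_convergence[OF u(1), of p] True by blast
    let ?c = "(?X, \<lambda>n. v (2 * n + 1))"
    show ?thesis
    proof (rule that[of ?c])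
      have "Suc (2 * i) \<noteq> 2 * j" for i j by presburger
      then show "condition ?c"
        using X aff[of 2 1] by (auto simp: condition_def inj disj inj_def)
      show "extends ?c c" by (auto simp: extends_def c)
    next
      fix A C
      assume "realizes ?c A" and *: "closed C"
        "\<And>f. f \<in> enumerations A \<Longrightarrow> \<exists>g\<in>C. functional_maps p f g"
      then have "?X \<subseteq> A" by (simp add: realizes_def)
      then have "range f \<subseteq> A" using f(2) unfolding u(2) by (rule order_trans[rotated])
      with * f show "has_recursive_member C" by (intro closed_has_recursive_member_if_total_on_recursive)
    qed
  next
    case False
    \<comment> \<open>The first \<open>m\<close> values of \<open>h\<close> form a string such that
      \<open>p\<close> diverges at \<open>n\<close> on every extension with values in
      \<open>?X\<close>.\<close>
    then obtain h m n where h: "range h \<subseteq> ?X"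
      and div: "\<And>h' y. range h' \<subseteq> ?X \<Longrightarrow> \<forall>i<m. h' i = h i \<Longrightarrow> \<not> eval h' p [n] y"
      using u(2) by metis
    have "\<forall>i. \<exists>j. h i \<in> R \<or> h i = v (2 * j)" using h by blast
    then obtain w where w: "\<And>i. h i \<in> R \<or> h i = v (2 * w i)" by metis
    \<comment> \<open>All even-indexed elements occurring in the string have index below
      \<open>2 * k\<close>; \<open>Suc\<close> makes \<open>?S\<close>, and hence \<open>A\<close>,
      nonempty.\<close>
    define k where "k = Suc (sum w {..<m})"
    have wk: "w i < k" if "i < m" for i
      using member_le_sum[of i "{..<m}" w] that by (simp add: k_def)
    let ?S = "(\<lambda>j. v (2 * j)) ` {..<k}"
    let ?c = "(R \<union> ?S, \<lambda>j. v (2 * j + 2 * k))"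
    show ?thesis
    proof (rule that[of ?c])
      show "condition ?c"
        using ce_Un_finite[of ?S R] Rv(1) aff[of 2 "2 * k"]
        by (auto simp: condition_def inj disj inj_def)
      show "extends ?c c" by (auto simp: extends_def c)
    next
      fix A C
      assume A: "realizes ?c A" and "\<And>f. f \<in> enumerations A \<Longrightarrow> \<exists>g\<in>C. functional_maps p f g"
      \<comment> \<open>With the reserve discarded, \<open>A\<close> lies inside \<open>?X\<close>,
        where divergence is known.\<close>
      have "v (2 * j + 2 * k) \<in> ?X" for j
        using rangeI[of "\<lambda>n. v (2 * n)" "j + k"] unfolding distrib_left by (rule UnI2)
      then have "range (\<lambda>j. v (2 * j + 2 * k)) \<subseteq> ?X" by (rule image_subsetI)
      moreover have "?S \<subseteq> ?X" by auto
      moreover have "A \<subseteq> R \<union> ?S \<union> range (\<lambda>j. v (2 * j + 2 * k))" using A by (simp add: realizes_def)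
      ultimately have AX: "A \<subseteq> ?X" by (meson Un_upper1 le_sup_iff order_trans)
      have "h i \<in> A" if "i < m" for i
        using w[of i] wk[OF that] A by (auto simp: realizes_def)
      moreover have "A \<noteq> {}" using A by (auto simp: realizes_def k_def)
      ultimately obtain f where f: "f \<in> enumerations A" "\<And>i. i < m \<Longrightarrow> f i = h i"
        using enumeration_extending by blast
      then obtain g where "functional_maps p f g" using \<open>\<And>f. f \<in> enumerations A \<Longrightarrow> _\<close> by blast
      then have "eval f p [n] (g n)" by (simp add: functional_maps_def)
      moreover have "range f \<subseteq> ?X" using f(1) AX by (simp add: enumerations_def)
      \<comment> \<open>The enumeration \<open>f\<close> extends the string inside
        \<open>?X\<close>, so convergence at \<open>n\<close> is absurd: no reduction to
        \<open>C\<close> exists for this \<open>A\<close>.\<close>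
      ultimately show "has_recursive_member C" using div f(2) by blast
    qed
  qed
qed

section \<open>A generic sequence of conditions\<close>

text \<open>Countability assigns a stage to each program, which is treated there both as a recursive
  enumeration and as a functional.\<close>

instance prog :: countable
  by countable_datatype

lemma exists_enumeration_problem_bounding_no_closed:
  "\<exists>A :: nat set. A \<noteq> {} \<and> \<not> has_recursive_member (enumerations A) \<and>
     (\<forall>\<C>. closed \<C> \<and> \<C> \<le>\<^sub>s enumerations A \<longrightarrow> has_recursive_member \<C>)"
proof -
  \<comment> \<open>Quantifying over all sets that realize \<open>c\<close> lets the final
    \<open>A\<close>, not yet known at this stage, inherit the property.\<close>
  define good where "good p c \<longleftrightarrow> (\<forall>A. realizes c A \<longrightarrow>
      (\<forall>g. (\<forall>n. eval (\<lambda>_. 0) p [n] (g n)) \<longrightarrow> A \<noteq> range g) \<and>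
      (\<forall>C. closed C \<longrightarrow> (\<forall>f\<in>enumerations A. \<exists>g\<in>C. functional_maps p f g) \<longrightarrow>
        has_recursive_member C))" for p c
  have "\<exists>c'. condition c' \<and> extends c' c \<and> good p c'" if c: "condition c" for c p
  proof -
    \<comment> \<open>If \<open>p\<close> is not total, \<open>THE\<close> supplies arbitrary
      values, which \<open>force_not_range\<close> allows; if \<open>p\<close> computes a total
      \<open>g\<close>, the function is \<open>g\<close>.\<close>
    obtain b where b: "condition b" "extends b c"
      "\<And>A. realizes b A \<Longrightarrow> A \<noteq> range (\<lambda>n. THE y. eval (\<lambda>_. 0) p [n] y)"
      using force_not_range[OF c] by blast
    obtain a where a: "condition a" "extends a b"
      "\<And>A C. realizes a A \<Longrightarrow> closed C \<Longrightarrow>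
        (\<And>f. f \<in> enumerations A \<Longrightarrow> \<exists>g\<in>C. functional_maps p f g) \<Longrightarrow> has_recursive_member C"
      using force_closed_image[OF b(1), where p = p] by blast
    have "A \<noteq> range g" if "realizes a A" "\<And>n. eval (\<lambda>_. 0) p [n] (g n)" for A g
    proof -
      have "(\<lambda>n. THE y. eval (\<lambda>_. 0) p [n] y) = g"
        using that(2) eval_deterministic by (intro ext the_equality) blast+
      then show ?thesis using b(3) realizes_extends[OF a(2) that(1)] by metis
    qed
    then have "good p a" using a(3) unfolding good_def by blast
    then show ?thesis using a extends_trans b(2) by blast
  qed
  note step = this
  define next_c where "next_c c p = (SOME c'. condition c' \<and> extends c' c \<and> good p c')" for c p
  have next_c: "condition (next_c c p) \<and> extends (next_c c p) c \<and> good p (next_c c p)"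
    if "condition c" for c p
    unfolding next_c_def by (rule someI_ex) (rule step[OF that])
  \<comment> \<open>At the start \<open>0\<close> is in \<open>A\<close> and all positive numbers
    are undecided.\<close>
  define c where "c = rec_nat ({0}, Suc) (\<lambda>n c. next_c c (from_nat n))"
  have c_Suc: "c (Suc n) = next_c (c n) (from_nat n)" for n by (simp add: c_def)
  have cond: "condition (c n)" for n
  proof (induction n)
    case 0
    show ?case
      using ce_insert_empty[of 0] recursive_function_affine[of 1 1] by (auto simp: c_def condition_def)
  qed (simp add: c_Suc next_c)
  have ext: "extends (c m) (c n)" if "n \<le> m" for m n
    using that
  proof (induction m rule: dec_induct)
    case (step m)
    have "extends (c (Suc m)) (c m)" using next_c[OF cond] by (simp add: c_Suc)
    then show ?case using step.IH by (rule extends_trans)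
  qed (rule extends_refl)
  define A where "A = (\<Union>n. fst (c n))"
  have A: "realizes (c n) A" for n
  proof -
    \<comment> \<open>For \<open>m \<le> n\<close> the first components grow; for
      \<open>n \<le> m\<close> the later condition stays within the bound of the earlier
      one.\<close>
    have "fst (c m) \<subseteq> fst (c n) \<union> range (snd (c n))" for m
      using ext[of n m] ext[of m n] nat_le_linear[of m n]
      by (auto simp: extends_def split: prod.splits)
    then show ?thesis unfolding realizes_def A_def case_prod_beta by blast
  qed
  have good: "good p (c (Suc (to_nat p)))" for p
    using next_c[OF cond] by (simp add: c_Suc)
  have "0 \<in> A" unfolding A_def by (rule UN_I[of 0]) (auto simp: c_def)
  moreover have "\<not> has_recursive_member (enumerations A)"
    using good A unfolding good_def has_recursive_member_def enumerations_def recursive_function_def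
    by blast
  moreover have "has_recursive_member C" if "closed C" "C \<le>\<^sub>s enumerations A" for C
    using that good A unfolding good_def medvedev_le_def by blast
  ultimately show ?thesis by blast
qed

theorem theorem22:
  shows "(\<exists>A :: nat set. A \<noteq> {} \<and> \<not> has_recursive_member (enumerations A) \<and>
            (\<forall>\<C> :: (nat \<Rightarrow> nat) set.
               closed \<C> \<and> \<C> \<le>\<^sub>s enumerations A \<longrightarrow> has_recursive_member \<C>))
       \<and> (\<exists>a. degree_of_enumerability a \<and> \<not> zero_degree a \<and>
            \<not> (\<exists>c\<in>medvedev_degrees. closed_degree c \<and> \<not> zero_degree c \<and> degree_le c a))"
proof
  show ex: "\<exists>A :: nat set. A \<noteq> {} \<and> \<not> has_recursive_member (enumerations A) \<and>
            (\<forall>\<C> :: (nat \<Rightarrow> nat) set.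
               closed \<C> \<and> \<C> \<le>\<^sub>s enumerations A \<longrightarrow> has_recursive_member \<C>)"
    by (rule exists_enumeration_problem_bounding_no_closed)
  then obtain A :: "nat set" where A: "A \<noteq> {}" "\<not> has_recursive_member (enumerations A)"
    "\<And>\<C>. closed \<C> \<Longrightarrow> \<C> \<le>\<^sub>s enumerations A \<Longrightarrow> has_recursive_member \<C>"
    by blast
  let ?a = "medvedev_degree (enumerations A)"
  have "zero_degree c" if c: "c \<in> medvedev_degrees" "closed_degree c" "degree_le c ?a" for c
  proof -
    obtain \<D> where \<D>: "c = medvedev_degree \<D>" using c(1) by (auto simp: medvedev_degrees_def)
    obtain \<C> where \<C>: "\<C> \<in> c" "closed \<C>" using c(2) by (auto simp: closed_degree_def)
    obtain \<A> \<B> where AB: "\<A> \<in> c" "\<B> \<in> ?a" "\<A> \<le>\<^sub>s \<B>" using c(3) by (auto simp: degree_le_def)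
    \<comment> \<open>The closed member of \<open>c\<close> and the one witnessing
      \<open>degree_le\<close> may differ; equivalence within the degree carries the reduction
      over.\<close>
    have le: "\<X> \<le>\<^sub>s \<Y>" if "\<X> \<in> c" "\<Y> \<in> c" for \<X> \<Y>
      using that medvedev_le_trans unfolding \<D> medvedev_degree_def by blast
    have "\<C> \<le>\<^sub>s enumerations A"
      using le[OF \<C>(1) AB(1)] AB(2,3) medvedev_le_trans unfolding medvedev_degree_def by blast
    then have "has_recursive_member \<C>" using A(3) \<C>(2) by blast
    then show ?thesis
      using le \<C>(1) has_recursive_member_medvedev_le unfolding zero_degree_def by blast
  qed
  moreover have "\<not> zero_degree ?a"
    using A(2) medvedev_le_refl by (auto simp: zero_degree_def medvedev_degree_def)
  moreover have "degree_of_enumerability ?a" using A(1) by (auto simp: degree_of_enumerability_def)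
  ultimately show "\<exists>a. degree_of_enumerability a \<and> \<not> zero_degree a \<and>
      \<not> (\<exists>c\<in>medvedev_degrees. closed_degree c \<and> \<not> zero_degree c \<and> degree_le c a)"
    by blast
qed

end
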